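(* Let $g$ and $h$ be normalized positive valued arithmetic functions with $h(n)\geq 1$ for all $n\in\mathbb{N}$. Let $n\geq 1$ be fixed. Suppose there exists $\mu_n<0$ such that for all real $x$ with $\mu_n<x<0$ one has $Q_m^g(x)<0$ for all $1\leq m\leq n$. Then for all real $x$ with $\mu_n<x<0$ one has $P_m^{g,h}(x)<0$ for all $1\leq m\leq n$.
   Context: $\mathbb{N}=\{1,2,3,\dots\}$. An arithmetic function $f:\mathbb{N}\to\mathbb{R}$ is normalized if $f(1)=1$. For normalized positive valued arithmetic functions $g,h$, define polynomials by $P_0^{g,h}(z)=1$ and $$P_n^{g,h}(z)=\frac{z}{h(n)}\sum_{k=1}^n g(k)\,P_{n-k}^{g,h}(z),\qquad n\geq 1.$$ Let $Q_n^g(z)$ be the case where $h$ is the constant function $1$, i.e. $Q_0^g(z)=1$ and $Q_n^g(z)=z\sum_{k=1}^n g(k)\,Q_{n-k}^g(z)$ for $n\geq 1$. *)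

theory Defs
  imports Complex_Main "HOL-Computational_Algebra.Polynomial"
begin

text \<open>
  Arithmetic functions on the positive integers are represented by functions of type
  \<^typ>\<open>nat \<Rightarrow> real\<close>; their value at 0 is irrelevant and never constrained.
\<close>

definition normalized :: "(nat \<Rightarrow> real) \<Rightarrow> bool" where
  "normalized f \<longleftrightarrow> f 1 = 1"

definition positive_valued :: "(nat \<Rightarrow> real) \<Rightarrow> bool" where
  "positive_valued f \<longleftrightarrow> (\<forall>n\<ge>1. f n > 0)"

text \<open>The factor \<^term>\<open>[:0, 1 / h n:] :: real poly\<close> is the polynomial $z / h(n)$.\<close>

function P :: "(nat \<Rightarrow> real) \<Rightarrow> (nat \<Rightarrow> real) \<Rightarrow> nat \<Rightarrow> real poly" where
  "P g h 0 = 1"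
| "n \<ge> 1 \<Longrightarrow> P g h n = [:0, 1 / h n:] * (\<Sum>k=1..n. smult (g k) (P g h (n - k)))"
  by (auto, metis One_nat_def Suc_leI not_gr_zero)
termination by (relation "measure (\<lambda>(g, h, n). n)") auto

definition Q :: "(nat \<Rightarrow> real) \<Rightarrow> nat \<Rightarrow> real poly" where
  "Q g = P g (\<lambda>_. 1)"

lemma poly_P_0: "poly (P g h 0) z = 1"
  by simp

lemma poly_P_rec:
  "n \<ge> 1 \<Longrightarrow> poly (P g h n) z = z / h n * (\<Sum>k=1..n. g k * poly (P g h (n - k)) z)"
  by (simp add: poly_sum)

lemma poly_Q_0: "poly (Q g 0) z = 1"
  by (simp add: Q_def)

lemma poly_Q_rec:
  "n \<ge> 1 \<Longrightarrow> poly (Q g n) z = z * (\<Sum>k=1..n. g k * poly (Q g (n - k)) z)"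
  by (simp add: Q_def poly_sum)

end

theory Submission
  imports Defs "HOL-Computational_Algebra.Formal_Power_Series"
begin

text \<open>
  Fix \<open>x\<close> and put \<open>q\<^sub>m = Q\<^sub>m(x)\<close>, \<open>p\<^sub>m = P\<^sub>m(x)\<close>. With the generating functions
  \<open>G = \<Sum>\<^sub>k x g(k) t\<^sup>k\<close>, \<open>q = \<Sum>\<^sub>m q\<^sub>m t\<^sup>m\<close>, \<open>p = \<Sum>\<^sub>m p\<^sub>m t\<^sup>m\<close> and \<open>D = \<Sum>\<^sub>m (h(m) - 1) p\<^sub>m t\<^sup>m\<close>
  (without constant term), the recursions say \<open>q (1 - G) = 1\<close> and \<open>p (1 - G) + D = 1\<close>.
  Multiplying the second by \<open>q\<close> eliminates \<open>g\<close>: \<open>p + q D = q\<close>, that is,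
  \<open>h(m) p\<^sub>m = q\<^sub>m - \<Sum>\<^sub>k q\<^sub>k (h(m-k) - 1) p\<^sub>m\<^sub>-\<^sub>k\<close> with \<open>k\<close> running over \<open>1 \<le> k < m\<close>.
  If all \<open>q\<^sub>k\<close> are negative and \<open>h \<ge> 1\<close>, negativity of \<open>p\<^sub>m\<close> follows by strong induction.
\<close>

declare P.simps [simp del]

text \<open>Separate sequences \<open>a\<close> and \<open>b\<close> let it cover both
  \<open>a = b = q\<close> and \<open>a = p\<close>, \<open>b = p + d\<close>.\<close>

lemma fps_recursion:
  fixes g a b :: "nat \<Rightarrow> real"
  assumes "b 0 = 1" and "\<And>n. n \<ge> 1 \<Longrightarrow> b n = x * (\<Sum>k=1..n. g k * a (n - k))"
  shows "Abs_fps b = 1 + Abs_fps (\<lambda>k. if k = 0 then 0 else x * g k) * Abs_fps a"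
proof (rule fps_ext)
  fix n
  have "(\<Sum>i=0..n. (if i = 0 then 0 else x * g i) * a (n - i)) = x * (\<Sum>k=1..n. g k * a (n - k))"
    by (simp add: sum.atLeast_Suc_atMost sum_distrib_left mult.assoc)
  then show "fps_nth (Abs_fps b) n
      = fps_nth (1 + Abs_fps (\<lambda>k. if k = 0 then 0 else x * g k) * Abs_fps a) n"
    using assms by (cases "n = 0") (auto simp: fps_mult_nth)
qed

lemma poly_P_via_Q:
  assumes "m \<ge> 1" and h: "\<And>k. k \<ge> 1 \<Longrightarrow> h k \<noteq> 0"
  shows "h m * poly (P g h m) x
    = poly (Q g m) x - (\<Sum>k=1..<m. poly (Q g k) x * ((h (m - k) - 1) * poly (P g h (m - k)) x))"
proof -
  define p where "p k = poly (P g h k) x" for k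
  define q where "q k = poly (Q g k) x" for k
  \<comment> \<open>\<open>h 0\<close> is arbitrary; \<open>d 0 = 0\<close> keeps the constant term
    \<open>p 0 + d 0\<close> equal to 1.\<close>
  define d where "d k = (if k = 0 then 0 else (h k - 1) * p k)" for k
  define G where "G = Abs_fps (\<lambda>k. if k = 0 then 0 else x * g k)"
  have q: "Abs_fps q = 1 + G * Abs_fps q"
    unfolding G_def by (rule fps_recursion) (simp_all add: q_def poly_Q_0 poly_Q_rec)
  have "Abs_fps (\<lambda>k. p k + d k) = 1 + G * Abs_fps p"
    unfolding G_def
  proof (rule fps_recursion)
    show "p 0 + d 0 = 1" by (simp add: p_def d_def poly_P_0)
  next
    fix k :: nat assume k: "k \<ge> 1"
    then have "p k + d k = h k * p k" by (simp add: d_def algebra_simps)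
    also have "\<dots> = x * (\<Sum>i=1..k. g i * p (k - i))"
      using h[OF k] poly_P_rec[OF k, of g h x] by (simp add: p_def)
    finally show "p k + d k = x * (\<Sum>i=1..k. g i * p (k - i))" .
  qed
  moreover have "Abs_fps (\<lambda>k. p k + d k) = Abs_fps p + Abs_fps d"
    by (simp add: fps_eq_iff)
  ultimately have "Abs_fps p + Abs_fps d = 1 + G * Abs_fps p" by simp
  with q have "Abs_fps p + Abs_fps q * Abs_fps d = Abs_fps q"
    by algebra
  then have "fps_nth (Abs_fps p + Abs_fps q * Abs_fps d) m = fps_nth (Abs_fps q) m"
    by simp
  then have "p m + (\<Sum>i=0..m. q i * d (m - i)) = q m"
    by (simp add: fps_mult_nth)
  moreover have "(\<Sum>i=0..m. q i * d (m - i)) = d m + (\<Sum>i=1..<m. q i * d (m - i))"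
  proof -
    \<comment> \<open>Index \<open>0\<close> contributes \<open>d m\<close> since
      \<open>q 0 = 1\<close>; index \<open>m\<close> contributes nothing since
      \<open>d 0 = 0\<close>.\<close>
    have "{0..m} = insert 0 (insert m {1..<m})" using \<open>m \<ge> 1\<close> by auto
    then show ?thesis using \<open>m \<ge> 1\<close> by (simp add: q_def poly_Q_0 d_def)
  qed
  moreover have "(\<Sum>i=1..<m. q i * d (m - i)) = (\<Sum>i=1..<m. q i * ((h (m - i) - 1) * p (m - i)))"
    by (rule sum.cong) (auto simp: d_def)
  ultimately show ?thesis
    using \<open>m \<ge> 1\<close> by (simp add: d_def p_def q_def algebra_simps)
qed

lemma poly_P_neg:
  assumes h: "\<And>k. k \<ge> 1 \<Longrightarrow> h k \<ge> 1"
    and q: "\<And>k. 1 \<le> k \<Longrightarrow> k \<le> n \<Longrightarrow> poly (Q g k) x < 0"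
    and "1 \<le> m" "m \<le> n"
  shows "poly (P g h m) x < 0"
  using \<open>1 \<le> m\<close> \<open>m \<le> n\<close>
proof (induction m rule: less_induct)
  case (less m)
  have "0 \<le> (\<Sum>k=1..<m. poly (Q g k) x * ((h (m - k) - 1) * poly (P g h (m - k)) x))"
  proof (rule sum_nonneg)
    fix k assume k: "k \<in> {1..<m}"
    then have "poly (P g h (m - k)) x < 0"
      using less.prems by (intro less.IH) auto
    moreover have "h (m - k) \<ge> 1" using k by (intro h) auto
    moreover have "poly (Q g k) x < 0" using k less.prems by (intro q) auto
    ultimately show "0 \<le> poly (Q g k) x * ((h (m - k) - 1) * poly (P g h (m - k)) x)"
      by (intro mult_nonpos_nonpos mult_nonneg_nonpos) auto
  qed
  moreover have "h k \<noteq> 0" if "k \<ge> 1" for k using h[OF that] by simp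
  \<comment> \<open>A nonnegative sum is subtracted from the negative
    \<open>poly (Q g m) x\<close>.\<close>
  ultimately have "h m * poly (P g h m) x < 0"
    using poly_P_via_Q[of m h g x] q less.prems by fastforce
  then show ?case
    using h[of m] less.prems by (simp add: mult_less_0_iff)
qed

theorem theorem1p5:
  fixes g h :: "nat \<Rightarrow> real" and n :: nat and \<mu> :: real
  assumes "normalized g" and "positive_valued g"
    and "normalized h" and "positive_valued h"
    and "\<forall>k\<ge>1. h k \<ge> 1"
    and "n \<ge> 1"
    and "\<mu> < 0"
    and "\<forall>x. \<mu> < x \<and> x < 0 \<longrightarrow> (\<forall>m. 1 \<le> m \<and> m \<le> n \<longrightarrow> poly (Q g m) x < 0)"
  shows "\<forall>x. \<mu> < x \<and> x < 0 \<longrightarrow> (\<forall>m. 1 \<le> m \<and> m \<le> n \<longrightarrow> poly (P g h m) x < 0)"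
  using assms(5,8) by (blast intro: poly_P_neg)

end
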